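(* Let $S, T$ be finite sets of integers and let $\phi: S^\infty \to T^\infty$ be a non-erasing morphism. Then $\phi$ is an anchor if and only if $\mathrm{slope}(\phi(s)) = \mathrm{slope}(\phi(s'))$ for all $s,s' \in S$.
   Context: $\mathbb{N}$ denotes the positive integers. Alphabets $S,T$ are finite sets of integers. $S^*$ is the set of finite words over $S$ (including the empty word), $S^{\mathbb{N}}$ the set of infinite words $x_1x_2x_3\cdots$ with $x_i\in S$, and $S^\infty = S^*\cup S^{\mathbb{N}}$. The nonempty factors of an infinite word $\omega = x_1x_2\cdots$ are the finite words $x_m x_{m+1}\cdots x_n$, $m\le n$. $|B|$ is the length of a finite word $B$, and $\sum B$ is the sum of its letters. $\omega$ has bounded additive complexity if there is $M\in\mathbb{N}$ such that for every $n\in\mathbb{N}$ the set $\{\sum B : B \text{ a factor of } \omega,\ |B|=n\}$ has at most $M$ elements. For a nonempty finite word $B$, $\mathrm{slope}(B) = \frac{1}{|B|}\sum B$. A morphism $\phi: S^\infty\to T^\infty$ satisfies $\phi(BB') = \phi(B)\phi(B')$ for all $B\in S^*$, $B'\in S^\infty$; it is determined by the finite words $\phi(s)\in T^*$, $s \in S$, via $\phi(x_1x_2\cdots) = \phi(x_1)\phi(x_2)\cdots$ (for finite and infinite words). It is non-erasing if no nonempty word is mapped to the empty word. A non-erasing morphism $\phi$ anchors $\omega\in S^{\mathbb{N}}$ if $\phi(\omega)\in T^{\mathbb{N}}$ has bounded additive complexity; $\phi$ is an anchor if it anchors every element of $S^{\mathbb{N}}$. *)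

theory Defs
  imports Complex_Main "HOL-Library.Stream"
begin

text \<open>Words that are finite or infinite. Infinite words are streams, so their letters are
  numbered from 0 instead of from 1.\<close>

datatype 'a fiword = FinWord (finite_word: "'a list") | InfWord (infinite_word: "'a stream")

text \<open>The set of finite and infinite words over an alphabet. The finite words alone are
  \<open>lists S\<close>, the infinite ones \<open>streams S\<close>.\<close>

definition fiwords :: "'a set \<Rightarrow> 'a fiword set" where
  "fiwords S = FinWord ` lists S \<union> InfWord ` streams S"

primrec append_word :: "'a list \<Rightarrow> 'a fiword \<Rightarrow> 'a fiword" (infixr "\<cdot>" 65) where
  "B \<cdot> FinWord C = FinWord (B @ C)"
| "B \<cdot> InfWord x = InfWord (B @- x)"

definition is_factor :: "'a list \<Rightarrow> 'a stream \<Rightarrow> bool" where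
  "is_factor B x \<longleftrightarrow> (\<exists>m n. m \<le> n \<and> B = map (snth x) [m..<Suc n])"

definition bounded_additive_complexity :: "int stream \<Rightarrow> bool" where
  "bounded_additive_complexity x \<longleftrightarrow>
     (\<exists>M::nat. M \<ge> 1 \<and> (\<forall>n::nat. n \<ge> 1 \<longrightarrow>
        finite {sum_list B | B. is_factor B x \<and> length B = n} \<and>
        card {sum_list B | B. is_factor B x \<and> length B = n} \<le> M))"

text \<open>Only meaningful for nonempty words.\<close>

definition slope :: "int list \<Rightarrow> real" where
  "slope B = of_int (sum_list B) / of_nat (length B)"

text \<open>Besides compatibility with concatenation, a morphism sends finite words to finite words
  and its value on an infinite word is the concatenation of its values on the letters. The last
  clause expresses this: every finite prefix of the image of \<open>x\<close> already occurs as a prefix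
  of the image of some finite prefix of \<open>x\<close>. (The images of the finite prefixes of \<open>x\<close>
  are prefixes of the image of \<open>x\<close> by the third clause. For erasing morphisms the
  concatenation law alone would not determine the value on infinite words.)\<close>

definition is_morphism :: "'a set \<Rightarrow> 'b set \<Rightarrow> ('a fiword \<Rightarrow> 'b fiword) \<Rightarrow> bool" where
  "is_morphism S T \<phi> \<longleftrightarrow>
     (\<forall>w \<in> fiwords S. \<phi> w \<in> fiwords T) \<and>
     (\<forall>B \<in> lists S. \<exists>C \<in> lists T. \<phi> (FinWord B) = FinWord C) \<and>
     (\<forall>B \<in> lists S. \<forall>w \<in> fiwords S. \<phi> (B \<cdot> w) = finite_word (\<phi> (FinWord B)) \<cdot> \<phi> w) \<and>
     (\<forall>x \<in> streams S. \<forall>C v. \<phi> (InfWord x) = C \<cdot> v \<longrightarrow>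
        (\<exists>n D. \<phi> (FinWord (stake n x)) = FinWord (C @ D)))"

definition non_erasing :: "'a set \<Rightarrow> ('a fiword \<Rightarrow> 'b fiword) \<Rightarrow> bool" where
  "non_erasing S \<phi> \<longleftrightarrow> (\<forall>w \<in> fiwords S. w \<noteq> FinWord [] \<longrightarrow> \<phi> w \<noteq> FinWord [])"

definition anchors :: "int set \<Rightarrow> ('a fiword \<Rightarrow> int fiword) \<Rightarrow> 'a stream \<Rightarrow> bool" where
  "anchors T \<phi> x \<longleftrightarrow>
     (\<exists>y \<in> streams T. \<phi> (InfWord x) = InfWord y \<and> bounded_additive_complexity y)"

definition is_anchor :: "'a set \<Rightarrow> int set \<Rightarrow> ('a fiword \<Rightarrow> int fiword) \<Rightarrow> bool" where
  "is_anchor S T \<phi> \<longleftrightarrow> (\<forall>x \<in> streams S. anchors T \<phi> x)"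

end

theory Submission
  imports Defs "HOL-Library.Discrete_Functions"
begin

text \<open>Sliding a window of fixed length along a word over a finite alphabet changes its sum in
  bounded steps, so only boundedly many sums occur iff any two windows of equal length have sums
  within a fixed distance (a discrete intermediate value argument). If all \<open>\<phi>(s)\<close> have slope
  \<open>\<alpha>\<close>, the sum of a prefix of length \<open>n\<close> of \<open>\<phi>(x)\<close> is \<open>\<alpha> n + O(1)\<close>, and windows are differences
  of prefixes. If \<open>\<phi>(s)\<close> and \<open>\<phi>(s')\<close> have different slopes, an infinite word containing
  arbitrarily long powers of both letters has an image whose window sums spread without bound.\<close>

subsection \<open>Window sums\<close>

text \<open>A factor ends at an inclusive index and so is never empty; at length 0 the two sets
  would differ.\<close>

lemma factors_eq_windows:
  assumes "n \<ge> 1"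
  shows "{B. is_factor B x \<and> length B = n} = range (\<lambda>m. stake n (sdrop m x))"
proof -
  have map_snth: "map (snth x) [m..<m + n] = stake n (sdrop m x)" for m
    by (rule nth_equalityI) (simp_all add: sdrop_snth add.commute)
  show ?thesis
  proof (intro equalityI subsetI)
    fix B assume "B \<in> {B. is_factor B x \<and> length B = n}"
    then obtain m k where "m \<le> k" "B = map (snth x) [m..<Suc k]" "length B = n"
      by (auto simp: is_factor_def)
    moreover from this have "Suc k = m + n" by simp
    ultimately have "B = stake n (sdrop m x)"
      using map_snth[of m] by metis
    then show "B \<in> range (\<lambda>m. stake n (sdrop m x))" by simp
  next
    fix B assume "B \<in> range (\<lambda>m. stake n (sdrop m x))"
    then obtain m where B: "B = stake n (sdrop m x)" by auto
    have "Suc (m + n - 1) = m + n" using assms by simp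
    then have "m \<le> m + n - 1 \<and> B = map (snth x) [m..<Suc (m + n - 1)]"
      using assms B map_snth[of m] by simp
    then have "is_factor B x" unfolding is_factor_def by blast
    then show "B \<in> {B. is_factor B x \<and> length B = n}" using B by simp
  qed
qed

lemma factor_sums_eq_window_sums:
  assumes "n \<ge> 1"
  shows "{sum_list B | B. is_factor B x \<and> length B = n} =
    range (\<lambda>m. sum_list (stake n (sdrop m x)))"
proof -
  have "{sum_list B | B. is_factor B x \<and> length B = n} =
      sum_list ` {B. is_factor B x \<and> length B = n}" by blast
  then show ?thesis by (simp add: factors_eq_windows[OF assms] image_image)
qed

lemma window_sum_step:
  fixes x :: "int stream"
  shows "sum_list (stake n (sdrop (Suc m) x)) - sum_list (stake n (sdrop m x)) =
    x !! (m + n) - x !! m"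
proof -
  have "x !! m + sum_list (stake n (sdrop (Suc m) x)) = sum_list (stake (Suc n) (sdrop m x))"
    by simp
  also have "\<dots> = sum_list (stake n (sdrop m x)) + x !! (m + n)"
    unfolding stake_Suc by (simp add: sdrop_snth add.commute)
  finally show ?thesis by simp
qed

text \<open>An integer sequence with steps at most 1 skips no value, so its range contains the whole
  interval between any two of its values.\<close>

lemma card_range_ge_of_small_steps:
  fixes h :: "nat \<Rightarrow> int"
  assumes fin: "finite (range h)" and step: "\<And>i. \<bar>h (Suc i) - h i\<bar> \<le> 1"
  shows "\<bar>h i - h j\<bar> < int (card (range h))"
proof -
  have *: "h b - h a < int (card (range h))" if "h a \<le> h b" for a b
  proof -
    have "{h a..h b} \<subseteq> range h"
    proof
      fix v assume v: "v \<in> {h a..h b}"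
      show "v \<in> range h"
      proof (cases "a \<le> b")
        case True
        then show ?thesis
          using nat_intermed_int_val[of a b h v] step v by auto
      next
        case False
        \<comment> \<open>\<open>nat_intermed_int_val\<close> needs values that rise from the
          smaller index to the larger; here they fall, so it is applied to the negated
          sequence.\<close>
        have "\<bar>- h (Suc i) - - h i\<bar> \<le> 1" for i using step[of i] by linarith
        then show ?thesis
          using nat_intermed_int_val[of b a "\<lambda>i. - h i" "- v"] v False by auto
      qed
    qed
    then have "card {h a..h b} \<le> card (range h)"
      by (rule card_mono[OF fin])
    then show ?thesis using that by simp
  qed
  show ?thesis using *[of i j] *[of j i] by linarith
qed

text \<open>Dividing window sums by a bound \<open>E\<close> on their steps gives a sequence with
  steps at most 1 and at most \<open>M\<close> values. Multiplying back yields
  \<open>K = E * M\<close>, the same for all \<open>n\<close>.\<close>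

lemma bounded_additive_complexity_imp_window_sums_close:
  assumes "finite T" "x \<in> streams T" "bounded_additive_complexity x"
  obtains K where "\<And>n i j.
    \<bar>sum_list (stake n (sdrop i x)) - sum_list (stake n (sdrop j x))\<bar> \<le> K"
proof -
  obtain M where "\<forall>n::nat. n \<ge> 1 \<longrightarrow>
      finite {sum_list B | B. is_factor B x \<and> length B = n} \<and>
      card {sum_list B | B. is_factor B x \<and> length B = n} \<le> M"
    using assms(3) unfolding bounded_additive_complexity_def by blast
  then have M: "finite (range (\<lambda>m. sum_list (stake n (sdrop m x)))) \<and>
      card (range (\<lambda>m. sum_list (stake n (sdrop m x)))) \<le> M" if "n \<ge> 1" for n
    using that unfolding factor_sums_eq_window_sums[OF that, symmetric] by blast
  \<comment> \<open>The sum bounds every difference of two letters of \<open>T\<close>; the added 1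
    makes the bound strict and \<open>E\<close> positive.\<close>
  define E where "E = 1 + (\<Sum>t\<in>T. 2 * \<bar>t\<bar>)"
  have E: "E > 0" unfolding E_def by (smt (verit) sum_nonneg)
  have letter: "2 * \<bar>x !! i\<bar> \<le> E - 1" for i
    unfolding E_def using member_le_sum[of "x !! i" T "\<lambda>t. 2 * \<bar>t\<bar>"] assms(1,2)
    by (simp add: snth_in)
  have "\<bar>sum_list (stake n (sdrop i x)) - sum_list (stake n (sdrop j x))\<bar> \<le> E * int M" for n i j
  proof (cases "n = 0")
    case True
    then show ?thesis using E by simp
  next
    case False
    define W where "W m = sum_list (stake n (sdrop m x))" for m
    define h where "h m = W m div E" for m
    have fin: "finite (range W)" and card_W: "card (range W) \<le> M"
      using M[of n] False unfolding W_def by auto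
    have range_h: "range h = (\<lambda>v. v div E) ` range W"
      unfolding h_def by auto
    have W: "E * h m \<le> W m \<and> W m < E * h m + E" for m
      using E pos_mod_bound[of E "W m"] pos_mod_sign[of E "W m"] mult_div_mod_eq[of E "W m"]
      unfolding h_def by linarith
    have "\<bar>h (Suc m) - h m\<bar> \<le> 1" for m
    proof -
      have "\<bar>W (Suc m) - W m\<bar> < E"
        using window_sum_step[of n m x] letter[of m] letter[of "m + n"] unfolding W_def by linarith
      \<comment> \<open>One \<open>E\<close> comes from the step of \<open>W\<close>, the other from
        the remainder. Strictness leaves a difference of at most 1 between the integer
        quotients.\<close>
      then have "E * h (Suc m) < E * (h m + 2)" "E * h m < E * (h (Suc m) + 2)"
        using W[of m] W[of "Suc m"] by (auto simp: algebra_simps)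
      then show ?thesis using E by simp
    qed
    then have "\<bar>h i - h j\<bar> < int (card (range h))"
      using fin range_h by (intro card_range_ge_of_small_steps) auto
    also have "\<dots> \<le> int M"
      using card_image_le[OF fin, of "\<lambda>v. v div E"] card_W range_h by simp
    finally have hM: "\<bar>h i - h j\<bar> + 1 \<le> int M" by simp
    \<comment> \<open>The remainders cost at most one more \<open>E\<close>, which the 1 gained in
      \<open>hM\<close> absorbs.\<close>
    have "\<bar>W i - W j\<bar> \<le> E * \<bar>h i - h j\<bar> + E"
    proof -
      have "E * \<bar>h i - h j\<bar> = \<bar>E * h i - E * h j\<bar>"
        using E by (simp add: abs_mult flip: right_diff_distrib)
      then show ?thesis using W[of i] W[of j] by linarith
    qed
    also have "\<dots> = E * (\<bar>h i - h j\<bar> + 1)" by (simp add: algebra_simps)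
    also have "\<dots> \<le> E * int M" using hM E by (intro mult_left_mono) auto
    finally show ?thesis unfolding W_def .
  qed
  then show ?thesis using that by blast
qed

text \<open>All sums of windows of length \<open>n\<close> lie within \<open>K\<close> of the sum of
  the first one, hence in an interval of \<open>2 * K + 1\<close> integers.\<close>

lemma window_sums_close_imp_bounded_additive_complexity:
  assumes K: "\<And>n i j. \<bar>sum_list (stake n (sdrop i x)) - sum_list (stake n (sdrop j x))\<bar> \<le> K"
  shows "bounded_additive_complexity x"
proof -
  have K0: "K \<ge> 0" using K[of 0 0 0] by simp
  have "finite (range (\<lambda>m. sum_list (stake n (sdrop m x)))) \<and>
      card (range (\<lambda>m. sum_list (stake n (sdrop m x)))) \<le> nat (2 * K + 1)" for n
  proof -
    define a where "a = sum_list (stake n (sdrop 0 x))"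
    have sub: "range (\<lambda>m. sum_list (stake n (sdrop m x))) \<subseteq> {a - K..a + K}"
    proof
      fix v assume "v \<in> range (\<lambda>m. sum_list (stake n (sdrop m x)))"
      then obtain m where "v = sum_list (stake n (sdrop m x))" by auto
      then show "v \<in> {a - K..a + K}" using K[of n m 0] by (auto simp: a_def)
    qed
    show ?thesis using finite_subset[OF sub] card_mono[OF _ sub] by (simp add: algebra_simps)
  qed
  then show ?thesis
    unfolding bounded_additive_complexity_def using K0
    by (intro exI[of _ "nat (2 * K + 1)"]) (auto simp: factor_sums_eq_window_sums)
qed

lemma window_sum_eq_prefix_sums:
  fixes x :: "int stream"
  shows "sum_list (stake n (sdrop m x)) = sum_list (stake (m + n) x) - sum_list (stake m x)"
  using arg_cong[OF stake_add[of m x n], of sum_list] by (simp del: stake_add)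

subsection \<open>Images of words under a letterwise substitution\<close>

text \<open>A complete block \<open>f s\<close> has deviation 0 from the line of slope \<alpha>, so
  only the block cut off by the prefix contributes. There are finitely many beginnings of
  blocks.\<close>

lemma prefix_sum_near_slope_line:
  fixes \<alpha> :: real
  assumes "finite S" and slope: "\<And>s. s \<in> S \<Longrightarrow> real_of_int (sum_list (f s)) = \<alpha> * length (f s)"
  obtains C where "\<And>B n. set B \<subseteq> S \<Longrightarrow> n \<le> length (concat (map f B)) \<Longrightarrow>
    \<bar>real_of_int (sum_list (take n (concat (map f B)))) - \<alpha> * n\<bar> \<le> C"
proof -
  define dev where "dev B n = \<bar>real_of_int (sum_list (take n B)) - \<alpha> * n\<bar>" for B n
  \<comment> \<open>A sum of nonnegative deviations stands in for their maximum.\<close>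
  define C where "C = (\<Sum>s\<in>S. \<Sum>n\<le>length (f s). dev (f s) n)"
  have dev_nonneg: "dev B n \<ge> 0" for B n by (simp add: dev_def)
  have C0: "C \<ge> 0" unfolding C_def by (intro sum_nonneg) (simp add: dev_nonneg)
  have C: "dev (f s) n \<le> C" if "s \<in> S" "n \<le> length (f s)" for s n
  proof -
    have "dev (f s) n \<le> (\<Sum>n\<le>length (f s). dev (f s) n)"
      using that by (intro member_le_sum) (auto simp: dev_nonneg)
    also have "\<dots> \<le> C"
      unfolding C_def using that assms(1)
      by (intro member_le_sum) (auto intro!: sum_nonneg simp: dev_nonneg)
    finally show ?thesis .
  qed
  have "dev (concat (map f B)) n \<le> C" if "set B \<subseteq> S" "n \<le> length (concat (map f B))" for B n
    using that
  proof (induction B arbitrary: n)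
    case Nil
    then show ?case using C0 by (simp add: dev_def)
  next
    case (Cons b B)
    show ?case
    proof (cases "n \<le> length (f b)")
      case True
      then have "dev (concat (map f (b # B))) n = dev (f b) n" by (simp add: dev_def)
      then show ?thesis using C[OF _ True] Cons.prems by simp
    next
      case False
      \<comment> \<open>The first block is read completely and cancels against
        \<open>\<alpha> * length (f b)\<close>.\<close>
      have "dev (concat (map f (b # B))) n = dev (concat (map f B)) (n - length (f b))"
        using False slope[of b] Cons.prems(1) by (simp add: dev_def algebra_simps)
      then show ?thesis using Cons.IH[of "n - length (f b)"] Cons.prems False by simp
    qed
  qed
  then show ?thesis using that unfolding dev_def by blast
qed

lemma length_concat_map_ge:
  assumes "\<And>s. s \<in> set B \<Longrightarrow> f s \<noteq> []"
  shows "length B \<le> length (concat (map f B))"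
  using assms
proof (induction B)
  case (Cons b B)
  have "length (f b) \<ge> 1" using Cons.prems[of b] by (cases "f b") auto
  then show ?case using Cons by simp
qed simp

text \<open>Hypothesis \<open>y\<close> describes the image of \<open>x\<close> by its prefixes
  alone, so that the argument deals with lists and streams only.\<close>

lemma equal_slopes_imp_bounded_additive_complexity:
  fixes \<alpha> :: real
  assumes "finite S" and ne: "\<And>s. s \<in> S \<Longrightarrow> f s \<noteq> []"
    and slope: "\<And>s. s \<in> S \<Longrightarrow> real_of_int (sum_list (f s)) = \<alpha> * length (f s)"
    and x: "x \<in> streams S"
    and y: "\<And>k. stake (length (concat (map f (stake k x)))) y = concat (map f (stake k x))"
  shows "bounded_additive_complexity y"
proof -
  obtain C where C: "\<And>B n. set B \<subseteq> S \<Longrightarrow> n \<le> length (concat (map f B)) \<Longrightarrow>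
      \<bar>real_of_int (sum_list (take n (concat (map f B)))) - \<alpha> * n\<bar> \<le> C"
    using prefix_sum_near_slope_line[where f=f and \<alpha>=\<alpha>, OF assms(1) slope] by blast
  have prefix: "\<bar>real_of_int (sum_list (stake n y)) - \<alpha> * n\<bar> \<le> C" for n
  proof -
    have sub: "set (stake n x) \<subseteq> S"
      using x by (auto simp: in_set_conv_nth snth_in)
    \<comment> \<open>Each letter contributes at least one letter, so the image of \<open>n\<close>
      letters covers the first \<open>n\<close> letters of \<open>y\<close>.\<close>
    have len: "n \<le> length (concat (map f (stake n x)))"
      using length_concat_map_ge[of "stake n x" f] ne sub by auto
    have "take n (concat (map f (stake n x))) = stake n y"
      using len y[of n] by (metis take_stake min.absorb1)
    then show ?thesis using C[OF sub len] by simp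
  qed
  \<comment> \<open>Two windows are compared, each the difference of two prefixes with error at most
    \<open>C\<close>.\<close>
  have "\<bar>sum_list (stake n (sdrop i y)) - sum_list (stake n (sdrop j y))\<bar> \<le> \<lceil>4 * C\<rceil>" for n i j
  proof -
    have window: "\<bar>real_of_int (sum_list (stake n (sdrop m y))) - \<alpha> * n\<bar> \<le> 2 * C" for m
      using prefix[of "m + n"] prefix[of m]
      by (simp add: window_sum_eq_prefix_sums algebra_simps del: stake_add)
    have "real_of_int \<bar>sum_list (stake n (sdrop i y)) - sum_list (stake n (sdrop j y))\<bar> \<le> 4 * C"
      using window[of i] window[of j] by simp
    then show ?thesis by linarith
  qed
  then show ?thesis by (rule window_sums_close_imp_bounded_additive_complexity)
qed

text \<open>Transfers factors of \<open>x\<close> to windows of \<open>y\<close>: the image of the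
  first \<open>i + k\<close> letters begins with that of the first \<open>i\<close>, and cancelling
  the latter leaves the image of the factor at \<open>i\<close>.\<close>

lemma window_of_image:
  assumes y: "\<And>k. stake (length (concat (map f (stake k x)))) y = concat (map f (stake k x))"
  shows "stake (length (concat (map f (stake k (sdrop i x)))))
      (sdrop (length (concat (map f (stake i x)))) y) = concat (map f (stake k (sdrop i x)))"
proof -
  have "concat (map f (stake (i + k) x)) =
      concat (map f (stake i x)) @ concat (map f (stake k (sdrop i x)))"
    by (simp flip: stake_add)
  then have "stake (length (concat (map f (stake i x))) +
      length (concat (map f (stake k (sdrop i x))))) y =
      concat (map f (stake i x)) @ concat (map f (stake k (sdrop i x)))"
    using y[of "i + k"] by (metis length_append)
  then show ?thesis
    using y[of i] by (metis stake_add same_append_eq)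
qed

text \<open>The letter depends on the parity of the binary logarithm of the index, hence is constant
  on each dyadic block from \<open>2 ^ e\<close> to \<open>2 ^ (e + 1) - 1\<close>.\<close>

lemma stream_with_long_runs:
  obtains x where "x \<in> streams {s, s'}"
    and "\<And>k. \<exists>i. stake k (sdrop i x) = replicate k s"
    and "\<And>k. \<exists>i. stake k (sdrop i x) = replicate k s'"
proof -
  define x where "x = smap (\<lambda>i. if even (floor_log i) then s else s') nats"
  have x: "x !! i = (if even (floor_log i) then s else s')" for i
    by (simp add: x_def)
  \<comment> \<open>The block starting at \<open>2 ^ e\<close> has length \<open>2 ^ e > e\<close>,
    enough for a run of \<open>k\<close> letters. Below, \<open>e\<close> is \<open>2 * k\<close> or
    \<open>2 * k + 1\<close>, according to the parity wanted.\<close>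
  have run: "floor_log (2 ^ e + j) = e" if "j < k" "k \<le> e" for e j k :: nat
  proof (rule floor_log_eqI)
    have "j < 2 ^ e" using that less_exp[of e] by linarith
    then show "2 ^ e + j < 2 * 2 ^ e" by simp
  qed auto
  have "stake k (sdrop (2 ^ (2 * k)) x) = replicate k s" for k
    by (rule nth_equalityI) (simp_all add: sdrop_snth x run[where k=k])
  moreover have "stake k (sdrop (2 ^ (2 * k + 1)) x) = replicate k s'" for k
    by (rule nth_equalityI)
      (simp_all add: sdrop_snth x run[where k=k and e="Suc (2 * k)", simplified])
  moreover have "x \<in> streams {s, s'}" by (simp add: streams_iff_snth x)
  ultimately show ?thesis using that by blast
qed

text \<open>The conclusion is equality of slopes with denominators cleared. Runs of
  \<open>n * ?q\<close> letters \<open>s\<close> and of \<open>n * ?p\<close> letters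
  \<open>s'\<close> have images of the same length, whose sums differ by
  \<open>n * d\<close>.\<close>

lemma long_runs_imp_equal_slopes:
  assumes close: "\<And>n i j.
      \<bar>sum_list (stake n (sdrop i y)) - sum_list (stake n (sdrop j y))\<bar> \<le> K"
    and y: "\<And>k. stake (length (concat (map f (stake k x)))) y = concat (map f (stake k x))"
    and runs: "\<And>k. \<exists>i. stake k (sdrop i x) = replicate k s"
      "\<And>k. \<exists>i. stake k (sdrop i x) = replicate k s'"
  shows "int (length (f s')) * sum_list (f s) = int (length (f s)) * sum_list (f s')"
proof (rule ccontr)
  let ?p = "length (f s)" and ?q = "length (f s')"
  define d where "d = int ?q * sum_list (f s) - int ?p * sum_list (f s')"
  assume "\<not> ?thesis"
  \<comment> \<open>\<open>d\<close> is a nonzero integer.\<close>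
  then have d: "\<bar>d\<bar> \<ge> 1" by (simp add: d_def)
  have power: "\<exists>m. sum_list (stake (k * length (f t)) (sdrop m y)) = int k * sum_list (f t)"
    if run: "\<exists>i. stake k (sdrop i x) = replicate k t" for k t
  proof -
    obtain i where i: "stake k (sdrop i x) = replicate k t" using run by blast
    have "length (concat (replicate k (f t))) = k * length (f t)"
      by (induction k) auto
    moreover have "sum_list (concat (replicate k (f t))) = int k * sum_list (f t)"
      by (induction k) (auto simp: algebra_simps)
    ultimately show ?thesis
      using window_of_image[where f=f and k=k and i=i, OF y] i by (metis map_replicate)
  qed
  \<comment> \<open>With \<open>n > K\<close>, the difference \<open>n * d\<close> of the two window
    sums exceeds \<open>K\<close> in absolute value.\<close>
  define n where "n = nat (K + 1)"
  obtain i where i: "sum_list (stake (n * ?q * ?p) (sdrop i y)) = int (n * ?q) * sum_list (f s)"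
    using power[OF runs(1), of "n * ?q"] by blast
  obtain j where j: "sum_list (stake (n * ?p * ?q) (sdrop j y)) = int (n * ?p) * sum_list (f s')"
    using power[OF runs(2), of "n * ?p"] by blast
  have comm: "n * ?p * ?q = n * ?q * ?p" by simp
  have "\<bar>int (n * ?q) * sum_list (f s) - int (n * ?p) * sum_list (f s')\<bar> \<le> K"
    using close[of "n * ?q * ?p" i j] i j unfolding comm by simp
  then have "\<bar>int n * d\<bar> \<le> K" by (simp add: d_def algebra_simps)
  moreover have "int n \<le> \<bar>int n * d\<bar>"
    using d mult_left_mono[of 1 "\<bar>d\<bar>" "int n"] by (simp add: abs_mult)
  ultimately show False unfolding n_def by linarith
qed

subsection \<open>Morphisms\<close>

lemma morphism_finite:
  assumes "is_morphism S T \<phi>" "B \<in> lists S"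
  shows "\<phi> (FinWord B) = FinWord (concat (map (\<lambda>s. finite_word (\<phi> (FinWord [s]))) B))"
proof -
  have fin: "\<exists>D. \<phi> (FinWord B) = FinWord D" if "B \<in> lists S" for B
    using assms(1) that unfolding is_morphism_def by blast
  have app: "\<phi> (FinWord (B @ C)) = FinWord (finite_word (\<phi> (FinWord B)) @ finite_word (\<phi> (FinWord C)))"
    if "B \<in> lists S" "C \<in> lists S" for B C
  proof -
    have "FinWord C \<in> fiwords S" using that by (simp add: fiwords_def)
    then have "\<phi> (B \<cdot> FinWord C) = finite_word (\<phi> (FinWord B)) \<cdot> \<phi> (FinWord C)"
      using assms(1) that unfolding is_morphism_def by blast
    then show ?thesis using fin[OF that(2)] by auto
  qed
  show ?thesis using assms(2)
  proof (induction B)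
    case Nil
    \<comment> \<open>The concatenation law gives \<open>D = D @ D\<close>, so the empty word is
      mapped to itself.\<close>
    obtain D where "\<phi> (FinWord []) = FinWord D" using fin[of "[]"] by auto
    then show ?case using app[of "[]" "[]"] by simp
  next
    case (Cons b B)
    then show ?case using app[of "[b]" B] by simp
  qed
qed

text \<open>Supplies the description of the image by prefixes used above. Splitting \<open>x\<close>
  after \<open>k\<close> letters makes the image of each prefix a prefix of
  \<open>\<phi> (InfWord x)\<close>; it remains to see that this image is infinite.\<close>

lemma morphism_infinite:
  assumes mor: "is_morphism S T \<phi>" and "non_erasing S \<phi>" and x: "x \<in> streams S"
  defines "f \<equiv> \<lambda>s. finite_word (\<phi> (FinWord [s]))"
  obtains y where "y \<in> streams T" "\<phi> (InfWord x) = InfWord y"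
    "\<And>k. stake (length (concat (map f (stake k x)))) y = concat (map f (stake k x))"
proof -
  have stake_S: "stake k x \<in> lists S" for k
    using x by (auto simp: in_set_conv_nth snth_in)
  have sdrop_S: "InfWord (sdrop k x) \<in> fiwords S" for k
    using x by (simp add: fiwords_def streams_iff_snth sdrop_snth)
  have stake: "\<phi> (FinWord (stake k x)) = FinWord (concat (map f (stake k x)))" for k
    unfolding f_def by (rule morphism_finite[OF mor stake_S])
  have split: "\<phi> (InfWord x) = concat (map f (stake k x)) \<cdot> \<phi> (InfWord (sdrop k x))" for k
  proof -
    have "\<phi> (stake k x \<cdot> InfWord (sdrop k x)) =
        finite_word (\<phi> (FinWord (stake k x))) \<cdot> \<phi> (InfWord (sdrop k x))"
      using mor stake_S sdrop_S unfolding is_morphism_def by blast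
    then show ?thesis by (simp add: stake stake_sdrop)
  qed
  \<comment> \<open>A finite image would be used up by some prefix of \<open>x\<close>, leaving the empty word as the
    image of the remaining suffix.\<close>
  have "\<phi> (InfWord x) \<noteq> FinWord C" for C
  proof
    assume C: "\<phi> (InfWord x) = FinWord C"
    then have "\<phi> (InfWord x) = C \<cdot> FinWord []" by simp
    then obtain k D where "\<phi> (FinWord (stake k x)) = FinWord (C @ D)"
      using mor x unfolding is_morphism_def by blast
    then have "FinWord C = (C @ D) \<cdot> \<phi> (InfWord (sdrop k x))"
      using split[of k] C stake[of k] by simp
    then have "\<phi> (InfWord (sdrop k x)) = FinWord []"
      by (cases "\<phi> (InfWord (sdrop k x))") auto
    then show False
      using \<open>non_erasing S \<phi>\<close> sdrop_S[of k] unfolding non_erasing_def by blast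
  qed
  then obtain y where y: "\<phi> (InfWord x) = InfWord y"
    by (cases "\<phi> (InfWord x)") auto
  have "InfWord x \<in> fiwords S" using x by (simp add: fiwords_def)
  then have "InfWord y \<in> fiwords T"
    using mor y unfolding is_morphism_def by metis
  then have "y \<in> streams T" by (auto simp: fiwords_def)
  moreover have "stake (length (concat (map f (stake k x)))) y = concat (map f (stake k x))" for k
  proof -
    obtain z where "y = concat (map f (stake k x)) @- z"
      using split[of k] y by (cases "\<phi> (InfWord (sdrop k x))") auto
    then show ?thesis by (simp add: stake_shift)
  qed
  ultimately show ?thesis using that y by blast
qed

theorem theorem3p1:
  fixes S T :: "int set" and \<phi> :: "int fiword \<Rightarrow> int fiword"
  assumes "finite S" and "finite T"
    and "is_morphism S T \<phi>" and "non_erasing S \<phi>"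
  shows "is_anchor S T \<phi> \<longleftrightarrow>
    (\<forall>s \<in> S. \<forall>s' \<in> S.
       slope (finite_word (\<phi> (FinWord [s]))) = slope (finite_word (\<phi> (FinWord [s']))))"
proof -
  define f where "f = (\<lambda>s. finite_word (\<phi> (FinWord [s])))"
  have ne: "f s \<noteq> []" if "s \<in> S" for s
  proof -
    have "[s] \<in> lists S" using that by simp
    then have "FinWord [s] \<in> fiwords S" unfolding fiwords_def by blast
    then have "\<phi> (FinWord [s]) \<noteq> FinWord []"
      using assms(4) unfolding non_erasing_def by blast
    moreover have "\<phi> (FinWord [s]) = FinWord (f s)"
      using morphism_finite[OF assms(3) \<open>[s] \<in> lists S\<close>] by (simp add: f_def)
    ultimately show ?thesis by simp
  qed
  have "is_anchor S T \<phi> \<longleftrightarrow> (\<forall>s \<in> S. \<forall>s' \<in> S. slope (f s) = slope (f s'))"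
  proof (intro iffI ballI)
    fix s s' assume anchor: "is_anchor S T \<phi>" and s: "s \<in> S" "s' \<in> S"
    obtain x where x: "x \<in> streams {s, s'}"
      and runs: "\<And>k. \<exists>i. stake k (sdrop i x) = replicate k s"
        "\<And>k. \<exists>i. stake k (sdrop i x) = replicate k s'"
      using stream_with_long_runs[of s s'] by blast
    have xS: "x \<in> streams S" using streams_mono2[of "{s, s'}" S] x s by auto
    obtain y where y: "y \<in> streams T" "\<phi> (InfWord x) = InfWord y"
      "\<And>k. stake (length (concat (map f (stake k x)))) y = concat (map f (stake k x))"
      using morphism_infinite[OF assms(3,4) xS] unfolding f_def by blast
    have "bounded_additive_complexity y"
      using anchor xS y(2) unfolding is_anchor_def anchors_def by auto
    then obtain K where K:
      "\<And>n i j. \<bar>sum_list (stake n (sdrop i y)) - sum_list (stake n (sdrop j y))\<bar> \<le> K"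
      using bounded_additive_complexity_imp_window_sums_close[OF assms(2) y(1)] by blast
    have "int (length (f s')) * sum_list (f s) = int (length (f s)) * sum_list (f s')"
      by (rule long_runs_imp_equal_slopes[OF K y(3) runs])
    \<comment> \<open>Over the reals, the identity can be divided by the two lengths, which are
      nonzero by \<open>ne\<close>.\<close>
    then have "real_of_int (int (length (f s')) * sum_list (f s)) =
        real_of_int (int (length (f s)) * sum_list (f s'))" by (rule arg_cong)
    then show "slope (f s) = slope (f s')"
      using ne[OF s(1)] ne[OF s(2)] by (simp add: slope_def field_simps)
  next
    assume slopes: "\<forall>s \<in> S. \<forall>s' \<in> S. slope (f s) = slope (f s')"
    show "is_anchor S T \<phi>"
      unfolding is_anchor_def
    proof
      fix x assume x: "x \<in> streams S"
      obtain y where y: "y \<in> streams T" "\<phi> (InfWord x) = InfWord y"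
        "\<And>k. stake (length (concat (map f (stake k x)))) y = concat (map f (stake k x))"
        using morphism_infinite[OF assms(3,4) x] unfolding f_def by blast
      \<comment> \<open>The common slope is read off at the first letter of \<open>x\<close>, which
        lies in \<open>S\<close>.\<close>
      have "real_of_int (sum_list (f s)) = slope (f (shd x)) * length (f s)" if "s \<in> S" for s
      proof -
        have "slope (f (shd x)) = slope (f s)" using slopes that streams_shd[OF x] by blast
        then show ?thesis using ne[OF that] by (simp add: slope_def)
      qed
      then have "bounded_additive_complexity y"
        using equal_slopes_imp_bounded_additive_complexity[OF assms(1) ne _ x y(3)] by blast
      then show "anchors T \<phi> x" using y unfolding anchors_def by blast
    qed
  qed
  then show ?thesis unfolding f_def .
qed

end
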